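(* Let $a>0$ and $t_k=\frac{k-1+a}{a}$ for $k\ge1$. Suppose that Assumption $A_1$ (local error bound condition) holds, let $(x_k)$ be generated by the Inertial Forward-Backward algorithm with this $(t_k)$, and let $x_*\in X$. Then, as $k\to\infty$: 1) $F(x_k)-F(x_* )=o\left(\frac{1}{k^{2(a+1)}}\right)$ and $\|x_k-x_{k-1}\|=O\left(\frac{1}{k^{a+1}}\right)$. 2) $(x_k)$ converges (in norm) to some $\bar x\in X$, with rate $\|x_k-\bar x\|=O\left(\frac{1}{k^a}\right)$.
   Context: Setting. $H$ is a real Hilbert space; $f:H\to\mathbb{R}$ is convex and continuously differentiable with $L_f$-Lipschitz continuous gradient ($L_f>0$); $g:H\to\mathbb{R}\cup\{+\infty\}$ is proper, lower semicontinuous and convex; $F:=f+g$. It is assumed that $X:=\arg\min F\neq\emptyset$, and $F_*:=\min F=F(x_* )$ for $x_*\in X$. For $\lambda>0$, $\mathrm{prox}_{\lambda g}(z):=\arg\min_{x\in H}\{g(x)+\frac{1}{2\lambda}\|x-z\|^2\}$ and $T_\lambda(x):=\mathrm{prox}_{\lambda g}(x-\lambda\nabla f(x))$. Inertial Forward-Backward algorithm (IFB). Fix $\mu\in(0,1)$, $\lambda=\mu/L_f$, a starting point $x_0\in H$, $y_1=x_0$, and the sequence $(t_k)_{k\ge1}$ (with $t_1=1$). For $k\ge1$: $x_k=T_\lambda(y_k)$ and $y_{k+1}=x_k+\gamma_k(x_k-x_{k-1})$, where $\gamma_k=\frac{t_k-1}{t_{k+1}}$. Assumption $A_1$ (local error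 bound condition): for any $\xi\ge F_*$ there exist $\varepsilon>0$ and $\bar\tau>0$ such that $\mathrm{dist}(x,X)\le\bar\tau\,\|T_{1/L_f}(x)-x\|$ whenever $\|T_{1/L_f}(x)-x\|<\varepsilon$ and $F(x)\le\xi$. *)

theory Defs
  imports "HOL-Analysis.Analysis" "HOL-Library.Landau_Symbols"
begin

definition proper :: "('a \<Rightarrow> ereal) \<Rightarrow> bool" where
  "proper g \<longleftrightarrow> (\<forall>x. g x \<noteq> -\<infinity>) \<and> (\<exists>x. g x \<noteq> \<infinity>)"

definition lower_semicontinuous :: "('a::topological_space \<Rightarrow> ereal) \<Rightarrow> bool" where
  "lower_semicontinuous g \<longleftrightarrow> (\<forall>x. g x \<le> Liminf (at x) g)"

(* In ereal, 0 * \<infinity> = 0, so the cases u = 0 and v = 0 are trivially satisfied. The library's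
   convex_on covers only real-valued functions. *)
definition convex_ereal :: "('a::real_vector \<Rightarrow> ereal) \<Rightarrow> bool" where
  "convex_ereal g \<longleftrightarrow> (\<forall>x y. \<forall>u\<ge>0. \<forall>v\<ge>0. u + v = 1 \<longrightarrow>
     g (u *\<^sub>R x + v *\<^sub>R y) \<le> ereal u * g x + ereal v * g y)"

definition objective :: "('a \<Rightarrow> real) \<Rightarrow> ('a \<Rightarrow> ereal) \<Rightarrow> 'a \<Rightarrow> ereal" where
  "objective f g x = ereal (f x) + g x"

definition minimizers :: "('a \<Rightarrow> ereal) \<Rightarrow> 'a set" where
  "minimizers F = {x. is_arg_min F (\<lambda>_. True) x}"

(* arg_min selects some minimizer. On a Hilbert space, for lam > 0 and g proper, lower
   semicontinuous and convex, there is exactly one. *)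
definition prox :: "real \<Rightarrow> ('a::real_inner \<Rightarrow> ereal) \<Rightarrow> 'a \<Rightarrow> 'a" where
  "prox lam g z = arg_min (\<lambda>x. g x + ereal (1 / (2 * lam) * (norm (x - z))\<^sup>2)) (\<lambda>_. True)"

(* gradf is the gradient of the smooth part f. *)
definition fb_step :: "real \<Rightarrow> ('a::real_inner \<Rightarrow> 'a) \<Rightarrow> ('a \<Rightarrow> ereal) \<Rightarrow> 'a \<Rightarrow> 'a" where
  "fb_step lam gradf g x = prox lam g (x - lam *\<^sub>R gradf x)"

(* The infimum below is min F whenever F has a minimizer. The level xi ranges over the reals, so
   eps and tau may deteriorate as xi grows. *)
definition local_error_bound ::
    "('a::real_inner \<Rightarrow> real) \<Rightarrow> ('a \<Rightarrow> 'a) \<Rightarrow> ('a \<Rightarrow> ereal) \<Rightarrow> real \<Rightarrow> bool" where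
  "local_error_bound f gradf g L \<longleftrightarrow>
     (\<forall>xi::real. (INF x. objective f g x) \<le> ereal xi \<longrightarrow>
       (\<exists>eps>0. \<exists>tau>0. \<forall>x.
          norm (fb_step (1 / L) gradf g x - x) < eps \<and> objective f g x \<le> ereal xi \<longrightarrow>
          infdist x (minimizers (objective f g)) \<le> tau * norm (fb_step (1 / L) gradf g x - x)))"

(* The value y 0 is not constrained: the extrapolated points are indexed from 1. *)
definition inertial_forward_backward ::
    "real \<Rightarrow> ('a::real_inner \<Rightarrow> 'a) \<Rightarrow> ('a \<Rightarrow> ereal) \<Rightarrow> (nat \<Rightarrow> real) \<Rightarrow>
     (nat \<Rightarrow> 'a) \<Rightarrow> (nat \<Rightarrow> 'a) \<Rightarrow> bool" where
  "inertial_forward_backward lam gradf g t x y \<longleftrightarrow>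
     y 1 = x 0 \<and>
     (\<forall>k\<ge>1. x k = fb_step lam gradf g (y k) \<and>
             y (k + 1) = x k + ((t k - 1) / t (k + 1)) *\<^sub>R (x k - x (k - 1)))"

end

theory Submission
  imports Defs "HOL-Real_Asymp.Real_Asymp"
begin

text \<open>One forward-backward step from z to p lowers F plus the proximity term
  \<open>norm (u - p)^2 / (2 lam)\<close>, up to a surplus proportional to \<open>norm (p - z)^2\<close> because
  \<open>lam < 1/L\<close>. Along the inertial iteration, with \<open>w k = F (x k) - min F\<close> and
  \<open>d k = norm (x k - x (k - 1))^2 / (2 lam)\<close>, the error bound makes this surplus eventually dominate
  a multiple of w, so that \<open>(1 + c) w (k + 1) + d (k + 1) \<le> w k + gam k^2 d k\<close>. Since
  \<open>gam k = (k - 1) / (k + a)\<close>, the weights \<open>(k - 1 + a) powr (2 (a + 1))\<close> absorb the factor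
  \<open>gam k^2\<close> by Bernoulli's inequality, and they grow so slowly that the gain c w pays for their growth
  on w. The weighted d is therefore bounded and the weighted w tends to zero; summing the step lengths
  gives convergence.\<close>

section \<open>Convex and smooth functions along a line\<close>

lemma DERIV_along_line:
  assumes "GDERIV f (z + s *\<^sub>R d) :> D"
  shows "((\<lambda>s. f (z + s *\<^sub>R d)) has_real_derivative d \<bullet> D) (at s)"
proof -
  have "((\<lambda>s. z + s *\<^sub>R d) has_derivative (\<lambda>h. h *\<^sub>R d)) (at s)"
    by (auto intro!: derivative_eq_intros)
  from has_derivative_compose[OF this assms[unfolded gderiv_def]] show ?thesis
    unfolding has_field_derivative_def by (simp add: mult_commute_abs)
qed

text \<open>Restricted to the line from \<open>z\<close> to \<open>u\<close>, \<open>f\<close> is a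
  convex function of one real variable and lies above its tangent at parameter 0; parameter 1 gives
  the claim.\<close>

lemma convex_on_gradient_inequality:
  assumes "convex_on UNIV f" "GDERIV f z :> D"
  shows "f z + D \<bullet> (u - z) \<le> f u"
proof -
  let ?h = "\<lambda>s::real. f (z + s *\<^sub>R (u - z))"
  have "convex_on UNIV ?h"
  proof (rule convex_onI)
    fix t p q :: real
    assume "t > 0" "t < 1"
    have "z + ((1 - t) *\<^sub>R p + t *\<^sub>R q) *\<^sub>R (u - z)
        = (1 - t) *\<^sub>R (z + p *\<^sub>R (u - z)) + t *\<^sub>R (z + q *\<^sub>R (u - z))"
      by (simp add: algebra_simps)
    then show "?h ((1 - t) *\<^sub>R p + t *\<^sub>R q) \<le> (1 - t) * ?h p + t * ?h q"
      using convex_onD[OF assms(1), of t] \<open>t > 0\<close> \<open>t < 1\<close> by auto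
  qed auto
  moreover have "(?h has_real_derivative (u - z) \<bullet> D) (at 0 within UNIV)"
    using DERIV_along_line[of f z 0 "u - z" D] assms(2) by simp
  ultimately have "?h 1 - ?h 0 \<ge> ((u - z) \<bullet> D) * (1 - 0)"
    using convex_on_imp_above_tangent[of UNIV ?h 0 1 "(u - z) \<bullet> D"] by simp
  then show ?thesis unfolding inner_commute[of D] by simp
qed

text \<open>Subtracting the linear and quadratic terms from \<open>f\<close> along the segment
  leaves a function \<open>h\<close> whose derivative is nonpositive, by Cauchy-Schwarz and the
  Lipschitz bound. Comparing \<open>h 1\<close> with \<open>h 0\<close> thus replaces integration of
  the gradient.\<close>

lemma descent_lemma:
  fixes f :: "'a::real_inner \<Rightarrow> real"
  assumes grad: "\<And>z. GDERIV f z :> gradf z" and lip: "L-lipschitz_on UNIV gradf"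
  shows "f u \<le> f z + gradf z \<bullet> (u - z) + L / 2 * (norm (u - z))\<^sup>2"
proof -
  define d where "d = u - z"
  define h where "h s = f (z + s *\<^sub>R d) - s * (gradf z \<bullet> d) - L / 2 * s\<^sup>2 * (norm d)\<^sup>2" for s
  have "h 1 \<le> h 0"
  proof (rule DERIV_nonpos_imp_nonincreasing[of 0 1 h])
    fix s :: real assume s: "0 \<le> s" "s \<le> 1"
    have "(h has_real_derivative
        d \<bullet> gradf (z + s *\<^sub>R d) - gradf z \<bullet> d - L * s * (norm d)\<^sup>2) (at s)"
      unfolding h_def
      by (auto intro!: derivative_eq_intros DERIV_along_line[OF grad] simp: power2_eq_square)
    moreover have "d \<bullet> gradf (z + s *\<^sub>R d) - gradf z \<bullet> d = d \<bullet> (gradf (z + s *\<^sub>R d) - gradf z)"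
      by (simp add: inner_diff_right inner_commute)
    moreover have "\<dots> \<le> norm d * norm (gradf (z + s *\<^sub>R d) - gradf z)"
      by (rule norm_cauchy_schwarz)
    moreover have "norm (gradf (z + s *\<^sub>R d) - gradf z) \<le> L * (s * norm d)"
      using lipschitz_onD[OF lip, of "z + s *\<^sub>R d" z] s by (simp add: dist_norm)
    then have "norm d * norm (gradf (z + s *\<^sub>R d) - gradf z) \<le> L * s * (norm d)\<^sup>2"
      using mult_left_mono[of _ _ "norm d"] by (fastforce simp: power2_eq_square ac_simps)
    ultimately show "\<exists>y. (h has_real_derivative y) (at s) \<and> y \<le> 0" by force
  qed simp
  then show ?thesis by (simp add: h_def d_def)
qed

section \<open>Extended-valued convex functions and proximal points\<close>

lemma convex_erealD:
  assumes "convex_ereal g" "g u = ereal r" "g v = ereal s" "0 \<le> t" "t \<le> 1"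
  shows "g ((1 - t) *\<^sub>R u + t *\<^sub>R v) \<le> ereal ((1 - t) * r + t * s)"
  using assms(1)[unfolded convex_ereal_def, rule_format, of "1 - t" t u v] assms(2-) by simp

text \<open>If \<open>g l\<close> exceeded \<open>b\<close>, a level \<open>q\<close> strictly
  between them would eventually lie below \<open>g (s n)\<close> and above
  \<open>c n\<close>.\<close>

lemma lower_semicontinuous_seq_le:
  fixes g :: "'a::t1_space \<Rightarrow> ereal"
  assumes lsc: "lower_semicontinuous g" and s: "s \<longlonglongrightarrow> l"
    and le: "\<And>n. g (s n) \<le> ereal (c n)" and c: "c \<longlonglongrightarrow> b"
  shows "g l \<le> ereal b"
proof (rule ccontr)
  assume "\<not> ?thesis"
  then obtain q where q: "ereal b < q" "q < g l"
    by (meson dense not_le)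
  with lsc have "q < Liminf (at l) g"
    unfolding lower_semicontinuous_def by (meson order.strict_trans2)
  then have "eventually (\<lambda>x. q < g x) (at l)"
    by (metis le_Liminf_iff order_refl)
  \<comment> \<open>The filter \<open>at l\<close> omits \<open>l\<close> itself, which the sequence
    may hit; \<open>q < g l\<close> covers that point.\<close>
  with q(2) have "eventually (\<lambda>x. q < g x) (nhds l)"
    by (auto simp: eventually_at_filter elim!: eventually_mono)
  from eventually_compose_filterlim[OF this s]
  have "eventually (\<lambda>n. q < g (s n)) sequentially" .
  moreover have "(\<lambda>n. ereal (c n)) \<longlonglongrightarrow> ereal b"
    using c by simp
  then have "eventually (\<lambda>n. ereal (c n) < q) sequentially"
    using q(1) by (rule order_tendstoD(2))
  ultimately have "eventually (\<lambda>n. False) sequentially"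
  proof eventually_elim
    case (elim n)
    with le[of n] show False by (meson le_less_trans less_asym)
  qed
  then show False by simp
qed

text \<open>The negative term is the strong convexity of the squared distance; it forces
  near-minimizers together. The weight is written \<open>1 - 1/2\<close> to match
  \<open>convex_erealD\<close> at \<open>t = 1/2\<close>.\<close>

lemma parallelogram_midpoint:
  fixes u v z :: "'a::real_inner"
  shows "(norm ((1 - 1/2) *\<^sub>R u + (1/2) *\<^sub>R v - z))\<^sup>2
    = (norm (u - z))\<^sup>2 / 2 + (norm (v - z))\<^sup>2 / 2 - (norm (u - v))\<^sup>2 / 4"
  by (simp add: power2_norm_eq_inner inner_diff inner_add inner_commute field_simps)

text \<open>Strong convexity makes every minimizing sequence Cauchy, so completeness and lower
  semicontinuity yield a minimizer without weak compactness. The bound \<open>m\<close> keeps the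
  infimum finite.\<close>

lemma ex_proximal_point:
  fixes g :: "'a::{real_inner, complete_space} \<Rightarrow> ereal"
  assumes "proper g" "lower_semicontinuous g" "convex_ereal g" "c > 0"
    and below: "\<And>u. ereal m \<le> g u + ereal (c * (norm (u - z))\<^sup>2)"
  shows "\<exists>p. is_arg_min (\<lambda>u. g u + ereal (c * (norm (u - z))\<^sup>2)) (\<lambda>_. True) p"
proof -
  let ?Q = "\<lambda>u. g u + ereal (c * (norm (u - z))\<^sup>2)"
  from \<open>proper g\<close> obtain v where "g v \<noteq> \<infinity>" unfolding proper_def by auto
  moreover have nminf: "g u \<noteq> -\<infinity>" for u
    using \<open>proper g\<close> unfolding proper_def by auto
  ultimately obtain v' where v: "?Q v = ereal v'"
    by (cases "g v") auto
  have "ereal m \<le> (INF u. ?Q u)" "(INF u. ?Q u) \<le> ereal v'"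
    using below v by (auto intro: INF_greatest INF_lower2[of v])
  then obtain b where b: "(INF u. ?Q u) = ereal b"
    by (cases "INF u. ?Q u") auto
  have b_le: "ereal b \<le> ?Q u" for u
    unfolding b[symmetric] by (rule INF_lower) simp
  have "\<exists>u r. g u = ereal r \<and> r + c * (norm (u - z))\<^sup>2 < b + 1 / real (Suc n)" for n
  proof -
    have "(INF u. ?Q u) < ereal (b + 1 / real (Suc n))"
      unfolding b by simp
    then obtain u where "?Q u < ereal (b + 1 / real (Suc n))"
      unfolding INF_less_iff by blast
    then show ?thesis
      using nminf[of u] by (cases "g u") auto
  qed
  then obtain s r where s: "\<And>n. g (s n) = ereal (r n)"
      "\<And>n. r n + c * (norm (s n - z))\<^sup>2 < b + 1 / real (Suc n)"
    by metis
  \<comment> \<open>The infimum is compared with the value at the midpoint of \<open>s i\<close> and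
    \<open>s j\<close>, where the parallelogram identity gains a multiple of their squared
    distance.\<close>
  have dist: "c / 2 * (norm (s i - s j))\<^sup>2 \<le> 1 / real (Suc i) + 1 / real (Suc j)" for i j
  proof -
    have "ereal b \<le> ereal ((1 - 1/2) * r i + 1/2 * r j)
        + ereal (c * (norm ((1 - 1/2) *\<^sub>R s i + (1/2) *\<^sub>R s j - z))\<^sup>2)"
      using convex_erealD[OF \<open>convex_ereal g\<close> s(1)[of i] s(1)[of j], of "1/2"]
      by (intro order_trans[OF b_le add_right_mono]) auto
    then have "b \<le> r i / 2 + r j / 2
        + c * ((norm (s i - z))\<^sup>2 / 2 + (norm (s j - z))\<^sup>2 / 2 - (norm (s i - s j))\<^sup>2 / 4)"
      unfolding parallelogram_midpoint by simp
    with s(2)[of i] s(2)[of j] show ?thesis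
      by (simp add: algebra_simps)
  qed
  have "Cauchy s"
  proof (rule metric_CauchyI)
    fix e :: real assume "e > 0"
    \<comment> \<open>Each of the two error terms in \<open>dist\<close> gets half of the allowance
      \<open>c / 2 * e^2\<close>.\<close>
    then have "c / 4 * e\<^sup>2 > 0" using \<open>c > 0\<close> by simp
    then obtain N where N: "1 / real (Suc N) < c / 4 * e\<^sup>2"
      by (metis nat_approx_posE)
    have "dist (s i) (s j) < e" if "i \<ge> N" "j \<ge> N" for i j
    proof -
      have "1 / real (Suc i) \<le> 1 / real (Suc N)" "1 / real (Suc j) \<le> 1 / real (Suc N)"
        using that by (auto simp: field_simps)
      with dist[of i j] N have "c / 2 * (norm (s i - s j))\<^sup>2 < c / 2 * e\<^sup>2"
        by simp
      with \<open>c > 0\<close> have "(norm (s i - s j))\<^sup>2 < e\<^sup>2" by simp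
      with \<open>e > 0\<close> show ?thesis
        by (simp add: dist_norm power_less_imp_less_base)
    qed
    then show "\<exists>M. \<forall>i\<ge>M. \<forall>j\<ge>M. dist (s i) (s j) < e" by blast
  qed
  then obtain p where p: "s \<longlonglongrightarrow> p"
    using Cauchy_convergent convergent_def by blast
  have "g p \<le> ereal (b + 0 - c * (norm (p - z))\<^sup>2)"
  proof (rule lower_semicontinuous_seq_le[OF assms(2) p])
    show "g (s n) \<le> ereal (b + 1 / real (Suc n) - c * (norm (s n - z))\<^sup>2)" for n
      using s[of n] by simp
    show "(\<lambda>n. b + 1 / real (Suc n) - c * (norm (s n - z))\<^sup>2)
        \<longlonglongrightarrow> b + 0 - c * (norm (p - z))\<^sup>2"
      using lim_1_over_n[THEN LIMSEQ_Suc] by (intro tendsto_intros p) auto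
  qed
  then have "?Q p \<le> ereal b"
    using nminf[of p] by (cases "g p") auto
  then show ?thesis
    using b_le by (auto simp: is_arg_min_linorder intro: order_trans)
qed

text \<open>This is the first-order optimality condition: \<open>(z - p) / lam\<close> is a
  subgradient of \<open>g\<close> at \<open>p\<close>. Finiteness at \<open>p\<close> follows by
  comparison with any point of the domain of \<open>g\<close>.\<close>

lemma proximal_point_subgradient:
  fixes g :: "'a::real_inner \<Rightarrow> ereal"
  assumes "proper g" "convex_ereal g" "lam > 0"
    and min: "is_arg_min (\<lambda>u. g u + ereal (1 / (2 * lam) * (norm (u - z))\<^sup>2)) (\<lambda>_. True) p"
  shows "\<exists>r. g p = ereal r"
    and "g p = ereal r \<Longrightarrow> g u = ereal s \<Longrightarrow> r + (z - p) \<bullet> (u - p) / lam \<le> s"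
proof -
  let ?c = "1 / (2 * lam)"
  have nminf: "g u \<noteq> -\<infinity>" for u
    using \<open>proper g\<close> unfolding proper_def by auto
  have le: "g p + ereal (?c * (norm (p - z))\<^sup>2) \<le> g u + ereal (?c * (norm (u - z))\<^sup>2)" for u
    using min by (auto simp: is_arg_min_linorder)
  obtain v where "g v \<noteq> \<infinity>" using \<open>proper g\<close> unfolding proper_def by auto
  with le[of v] have "g p \<noteq> \<infinity>" by (cases "g v") auto
  with nminf[of p] show "\<exists>r. g p = ereal r" by (cases "g p") auto
  assume gp: "g p = ereal r" and gu: "g u = ereal s"
  \<comment> \<open>Minimality is tested at the point of the segment from \<open>p\<close> to
    \<open>u\<close> with parameter \<open>t\<close>. After division by \<open>t\<close>, the
    quadratic term still has a factor \<open>t\<close> and disappears in the limit.\<close>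
  have le_t: "r + (z - p) \<bullet> (u - p) / lam - s \<le> ?c * t * (norm (u - p))\<^sup>2" if t: "0 < t" "t < 1" for t
  proof -
    let ?w = "(1 - t) *\<^sub>R p + t *\<^sub>R u"
    have "ereal (r + ?c * (norm (p - z))\<^sup>2) \<le> ereal ((1 - t) * r + t * s) + ereal (?c * (norm (?w - z))\<^sup>2)"
      using order_trans[OF le[of ?w] add_right_mono[OF convex_erealD[OF \<open>convex_ereal g\<close> gp gu, of t]]] t
      unfolding gp by simp
    moreover have w: "(norm (?w - z))\<^sup>2
        = (norm (p - z))\<^sup>2 - 2 * t * ((z - p) \<bullet> (u - p)) + t\<^sup>2 * (norm (u - p))\<^sup>2"
      unfolding power2_norm_eq_inner
      by (simp add: inner_diff inner_add inner_commute power2_eq_square algebra_simps)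
    ultimately have "t * (r + (z - p) \<bullet> (u - p) / lam - s) \<le> t * (?c * t * (norm (u - p))\<^sup>2)"
      unfolding w using \<open>lam > 0\<close>
      by (simp add: field_simps power2_eq_square)
    with t show ?thesis using mult_le_cancel_left_pos by blast
  qed
  have "eventually (\<lambda>t::real. t \<in> {0<..<1}) (at_right 0)"
    by (rule eventually_at_right_real) simp
  then have ev: "eventually (\<lambda>t. r + (z - p) \<bullet> (u - p) / lam - s \<le> ?c * t * (norm (u - p))\<^sup>2) (at_right 0)"
    by (rule eventually_mono) (rule le_t; simp)
  have lim: "((\<lambda>t. ?c * t * (norm (u - p))\<^sup>2) \<longlongrightarrow> ?c * 0 * (norm (u - p))\<^sup>2) (at_right 0)"
    by (intro tendsto_intros)
  have "r + (z - p) \<bullet> (u - p) / lam - s \<le> ?c * 0 * (norm (u - p))\<^sup>2"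
    by (rule tendsto_lowerbound[OF lim ev]) simp
  then show "r + (z - p) \<bullet> (u - p) / lam \<le> s" by simp
qed

section \<open>Estimates for one forward-backward step\<close>

locale composite_minimization =
  fixes f :: "'a::{real_inner, complete_space} \<Rightarrow> real"
    and gradf :: "'a \<Rightarrow> 'a"
    and g :: "'a \<Rightarrow> ereal"
    and L :: real
    and xstar :: 'a
  assumes convex_f: "convex_on UNIV f"
    and gradient: "\<And>z. GDERIV f z :> gradf z"
    and L_pos: "L > 0"
    and lipschitz: "L-lipschitz_on UNIV gradf"
    and proper_g: "proper g"
    and lsc_g: "lower_semicontinuous g"
    and convex_g: "convex_ereal g"
    and xstar: "xstar \<in> minimizers (objective f g)"
begin

text \<open>A real-valued version of \<open>g\<close> permits ordinary arithmetic. It is faithful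
  only where \<open>g\<close> is finite, since \<open>real_of_ereal\<close> maps infinity to 0;
  hence the recurring condition \<open>g u \<noteq> \<infinity>\<close>, also for
  \<open>Phi\<close>.\<close>

definition G :: "'a \<Rightarrow> real" where "G u = real_of_ereal (g u)"

definition Phi :: "'a \<Rightarrow> real" where "Phi u = f u + G u"

lemma g_eq: "g u \<noteq> \<infinity> \<Longrightarrow> g u = ereal (G u)"
  using proper_g unfolding proper_def G_def by (cases "g u") auto

lemma objective_eq: "g u \<noteq> \<infinity> \<Longrightarrow> objective f g u = ereal (Phi u)"
  unfolding objective_def Phi_def by (subst g_eq) simp_all

lemma objective_ge_minimizer: "z \<in> minimizers (objective f g) \<Longrightarrow> objective f g z \<le> objective f g u"
  by (simp add: minimizers_def is_arg_min_linorder)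

lemma minimizer_finite:
  assumes "z \<in> minimizers (objective f g)"
  shows "g z \<noteq> \<infinity>"
proof
  assume "g z = \<infinity>"
  obtain v where v: "g v \<noteq> \<infinity>" using proper_g unfolding proper_def by blast
  have "objective f g z \<le> ereal (Phi v)"
    using objective_ge_minimizer[OF assms] objective_eq[OF v] by metis
  with \<open>g z = \<infinity>\<close> show False by (simp add: objective_def)
qed

lemma Phi_ge_minimizer:
  assumes "z \<in> minimizers (objective f g)" "g u \<noteq> \<infinity>"
  shows "Phi z \<le> Phi u"
  using objective_ge_minimizer[OF assms(1), of u] objective_eq[OF assms(2)]
    objective_eq[OF minimizer_finite[OF assms(1)]] by simp

lemma Phi_minimizer: "z \<in> minimizers (objective f g) \<Longrightarrow> Phi z = Phi xstar"
  using Phi_ge_minimizer minimizer_finite xstar by (intro antisym) simp_all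

text \<open>Completing the square: up to a constant independent of \<open>u\<close>, the proximity
  term at the forward point is the proximity term at \<open>z\<close> plus the linear part of the
  model of \<open>f\<close>.\<close>

lemma norm_forward_step:
  assumes "lam > 0"
  shows "1 / (2 * lam) * (norm (u - (z - lam *\<^sub>R v)))\<^sup>2
    = 1 / (2 * lam) * (norm (u - z))\<^sup>2 + v \<bullet> (u - z) + lam / 2 * (norm v)\<^sup>2"
proof -
  have "(norm (u - (z - lam *\<^sub>R v)))\<^sup>2
      = (norm (u - z))\<^sup>2 + 2 * lam * (v \<bullet> (u - z)) + lam\<^sup>2 * (norm v)\<^sup>2"
    unfolding power2_norm_eq_inner
    by (simp add: inner_diff inner_commute power2_eq_square algebra_simps)
  then show ?thesis using assms by (simp add: field_simps power2_eq_square)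
qed

text \<open>For step sizes up to 1/L the quadratic upper bound on f turns the existence of a minimizer
  of f + g into a lower bound for the proximal objective, so no affine minorant of g is needed.\<close>

lemma fb_step_is_arg_min:
  assumes "0 < lam" "lam \<le> 1 / L"
  shows "is_arg_min (\<lambda>u. g u + ereal (1 / (2 * lam) * (norm (u - (z - lam *\<^sub>R gradf z)))\<^sup>2))
    (\<lambda>_. True) (fb_step lam gradf g z)"
proof -
  let ?w = "z - lam *\<^sub>R gradf z"
  have "L / 2 \<le> 1 / (2 * lam)"
    using assms L_pos by (simp add: field_simps)
  have "ereal (Phi xstar - f z) \<le> g u + ereal (1 / (2 * lam) * (norm (u - ?w))\<^sup>2)" for u
  proof (cases "g u = \<infinity>")
    case False
    have "f u \<le> f z + gradf z \<bullet> (u - z) + L / 2 * (norm (u - z))\<^sup>2"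
      using gradient lipschitz by (rule descent_lemma)
    moreover have "L / 2 * (norm (u - z))\<^sup>2 \<le> 1 / (2 * lam) * (norm (u - z))\<^sup>2"
      using \<open>L / 2 \<le> 1 / (2 * lam)\<close> by (rule mult_right_mono) simp
    moreover have "0 \<le> lam / 2 * (norm (gradf z))\<^sup>2" using assms(1) by simp
    moreover have "Phi xstar \<le> f u + G u"
      using Phi_ge_minimizer[OF xstar False] unfolding Phi_def .
    ultimately have "Phi xstar - f z \<le> G u + 1 / (2 * lam) * (norm (u - ?w))\<^sup>2"
      unfolding norm_forward_step[OF assms(1)] by linarith
    with False show ?thesis by (simp add: g_eq)
  qed simp
  then have "\<exists>p. is_arg_min (\<lambda>u. g u + ereal (1 / (2 * lam) * (norm (u - ?w))\<^sup>2)) (\<lambda>_. True) p"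
    using proper_g lsc_g convex_g assms(1) by (intro ex_proximal_point) auto
  then show ?thesis
    unfolding fb_step_def prox_def arg_min_def by (rule someI_ex)
qed

lemma fb_step_finite:
  assumes "0 < lam" "lam \<le> 1 / L"
  shows "g (fb_step lam gradf g z) \<noteq> \<infinity>"
  using proximal_point_subgradient(1)[OF proper_g convex_g assms(1) fb_step_is_arg_min[OF assms, of z]]
  by auto

text \<open>The optimality condition at the forward point: \<open>(z - p) / lam - gradf z\<close> is
  a subgradient of \<open>g\<close> at \<open>p\<close>.\<close>

lemma fb_step_subgradient:
  assumes "0 < lam" "lam \<le> 1 / L" and p: "p = fb_step lam gradf g z" and "g u \<noteq> \<infinity>"
  shows "G p + (z - p) \<bullet> (u - p) / lam - gradf z \<bullet> (u - p) \<le> G u"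
proof -
  have "G p + (z - lam *\<^sub>R gradf z - p) \<bullet> (u - p) / lam \<le> G u"
    unfolding p using assms(1,2,4)
    by (intro proximal_point_subgradient(2)[OF proper_g convex_g _ fb_step_is_arg_min] g_eq
        fb_step_finite) auto
  moreover have "(z - lam *\<^sub>R gradf z - p) \<bullet> (u - p) = (z - p) \<bullet> (u - p) - lam * (gradf z \<bullet> (u - p))"
    by (simp add: inner_diff_left)
  ultimately show ?thesis using assms(1) by (simp add: diff_divide_distrib)
qed

text \<open>Three inequalities are added: the quadratic upper bound for \<open>f\<close> at
  \<open>p\<close>, its gradient inequality at \<open>u\<close>, and the subgradient inequality for
  \<open>g\<close>. A three-point identity splits the inner product into squared norms. The choice
  of \<open>u\<close> stays free: the previous iterate gives the energy inequality, a nearby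
  minimizer the value gap.\<close>

lemma fb_step_descent:
  assumes "0 < lam" "lam \<le> 1 / L" and p: "p = fb_step lam gradf g z" and "g u \<noteq> \<infinity>"
  shows "Phi p + (norm (u - p))\<^sup>2 / (2 * lam) + (1 / (2 * lam) - L / 2) * (norm (p - z))\<^sup>2
    \<le> Phi u + (norm (u - z))\<^sup>2 / (2 * lam)"
proof -
  have "f p \<le> f z + gradf z \<bullet> (p - z) + L / 2 * (norm (p - z))\<^sup>2"
    using gradient lipschitz by (rule descent_lemma)
  moreover have "f z + gradf z \<bullet> (u - z) \<le> f u"
    using convex_f gradient by (rule convex_on_gradient_inequality)
  moreover have "G p + (z - p) \<bullet> (u - p) / lam - gradf z \<bullet> (u - p) \<le> G u"
    using assms by (rule fb_step_subgradient)
  moreover have "gradf z \<bullet> (u - p) = gradf z \<bullet> (u - z) - gradf z \<bullet> (p - z)"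
    by (simp add: inner_diff_right)
  moreover have "(z - p) \<bullet> (u - p) / lam
      = (norm (p - z))\<^sup>2 / (2 * lam) + (norm (u - p))\<^sup>2 / (2 * lam) - (norm (u - z))\<^sup>2 / (2 * lam)"
  proof -
    have "(z - p) \<bullet> (u - p) = ((norm (p - z))\<^sup>2 + (norm (u - p))\<^sup>2 - (norm (u - z))\<^sup>2) / 2"
      unfolding power2_norm_eq_inner by (simp add: inner_diff inner_commute)
    then show ?thesis by (simp add: add_divide_distrib diff_divide_distrib)
  qed
  moreover have "(1 / (2 * lam) - L / 2) * (norm (p - z))\<^sup>2
      = (norm (p - z))\<^sup>2 / (2 * lam) - L / 2 * (norm (p - z))\<^sup>2"
    by (simp add: left_diff_distrib)
  ultimately show ?thesis unfolding Phi_def by linarith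
qed

text \<open>The error bound measures the residual at \<open>p\<close> with step
  \<open>1 / L\<close>, while the iteration controls \<open>p - z\<close> with step
  \<open>lam\<close>. To relate them, the subgradient inequalities at \<open>p\<close> and
  \<open>q\<close> are each tested at the other point and added; Lipschitz continuity and division
  by \<open>norm (q - p)\<close> finish.\<close>

lemma fb_residual_le:
  assumes lam: "0 < lam" "lam \<le> 1 / L" and p: "p = fb_step lam gradf g z"
  shows "norm (fb_step (1 / L) gradf g p - p) \<le> (1 + 1 / (L * lam)) * norm (p - z)"
proof (cases "fb_step (1 / L) gradf g p = p")
  case True
  then show ?thesis using lam L_pos by simp
next
  case False
  define q where q: "q = fb_step (1 / L) gradf g p"
  have fin: "g p \<noteq> \<infinity>" "g q \<noteq> \<infinity>"
    unfolding p q by (rule fb_step_finite; use lam L_pos in simp)+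
  have "G p + (z - p) \<bullet> (q - p) / lam - gradf z \<bullet> (q - p) \<le> G q"
    using lam p fin(2) by (rule fb_step_subgradient)
  moreover have "G q + (p - q) \<bullet> (p - q) / (1 / L) - gradf p \<bullet> (p - q) \<le> G p"
    using L_pos q fin(1) by (intro fb_step_subgradient) auto
  moreover have "(p - q) \<bullet> (p - q) / (1 / L) = L * (norm (q - p))\<^sup>2"
    by (simp add: power2_norm_eq_inner norm_minus_commute[of q p])
  moreover have "gradf p \<bullet> (p - q) = - (gradf p \<bullet> (q - p))"
    "(p - z) \<bullet> (q - p) / lam = - ((z - p) \<bullet> (q - p) / lam)"
    "(gradf z - gradf p) \<bullet> (q - p) = gradf z \<bullet> (q - p) - gradf p \<bullet> (q - p)"
    by (simp_all add: inner_diff diff_divide_distrib)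
  ultimately have "L * (norm (q - p))\<^sup>2
      \<le> (gradf z - gradf p) \<bullet> (q - p) + (p - z) \<bullet> (q - p) / lam"
    by linarith
  also have "\<dots> \<le> (L * norm (p - z)) * norm (q - p) + norm (p - z) * norm (q - p) / lam"
  proof (intro add_mono divide_right_mono norm_cauchy_schwarz)
    have "(gradf z - gradf p) \<bullet> (q - p) \<le> norm (gradf z - gradf p) * norm (q - p)"
      by (rule norm_cauchy_schwarz)
    also have "\<dots> \<le> (L * norm (p - z)) * norm (q - p)"
      using lipschitz_onD[OF lipschitz, of z p]
      by (intro mult_right_mono) (auto simp: dist_norm norm_minus_commute)
    finally show "(gradf z - gradf p) \<bullet> (q - p) \<le> (L * norm (p - z)) * norm (q - p)" .
  qed (use lam(1) in simp)
  also have "\<dots> = (L * ((1 + 1 / (L * lam)) * norm (p - z))) * norm (q - p)"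
    using L_pos lam(1) by (simp add: field_simps)
  finally have "(L * norm (q - p)) * norm (q - p)
      \<le> (L * ((1 + 1 / (L * lam)) * norm (p - z))) * norm (q - p)"
    by (simp add: power2_eq_square mult.assoc)
  moreover have "norm (q - p) > 0" using False q by simp
  ultimately have "L * norm (q - p) \<le> L * ((1 + 1 / (L * lam)) * norm (p - z))"
    using mult_le_cancel_right_pos by blast
  then show ?thesis using L_pos unfolding q by simp
qed

text \<open>By \<open>fb_step_descent\<close> with a minimizer \<open>v\<close>, the gap is at most
  \<open>(norm (v - z)^2 - norm (v - p)^2) / (2 * lam)\<close>. The error bound puts some
  \<open>v\<close> within a multiple of \<open>norm (p - z)\<close> of \<open>p\<close>, so this
  difference is of second order in \<open>norm (p - z)\<close>.\<close>

lemma ex_value_gap_bound: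
  assumes lam: "0 < lam" "lam \<le> 1 / L" and error_bound: "local_error_bound f gradf g L"
  shows "\<exists>eps>0. \<exists>C>0. \<forall>z p. p = fb_step lam gradf g z \<longrightarrow> norm (p - z) < eps \<longrightarrow> Phi p \<le> xi
    \<longrightarrow> Phi p - Phi xstar \<le> C * (norm (p - z))\<^sup>2"
proof -
  let ?X = "minimizers (objective f g)"
  define K where "K = 1 + 1 / (L * lam)"
  have K: "K > 0" unfolding K_def using L_pos lam by (simp add: add_pos_pos)
  \<comment> \<open>The error bound speaks only of levels not below the minimum; the maximum with
    \<open>Phi xstar\<close> ensures this for every \<open>xi\<close>.\<close>
  have "(INF u. objective f g u) \<le> ereal (max xi (Phi xstar))"
    using objective_eq[OF minimizer_finite[OF xstar]] by (intro INF_lower2[of xstar]) auto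
  then obtain e tau where e: "e > 0" and tau: "tau > 0" and dist_le:
    "\<And>u. norm (fb_step (1 / L) gradf g u - u) < e \<Longrightarrow> objective f g u \<le> ereal (max xi (Phi xstar))
      \<Longrightarrow> infdist u ?X \<le> tau * norm (fb_step (1 / L) gradf g u - u)"
    using error_bound unfolding local_error_bound_def by meson
  \<comment> \<open>With \<open>r = norm (p - z)\<close>, the difference of squares is at most
    \<open>r^2 + 2 * r * norm (v - p)\<close>, and \<open>r * norm (v - p)\<close> will be at most
    \<open>(tau * K + 1) * r^2\<close>.\<close>
  define C where "C = (1 + 2 * (tau * K + 1)) / (2 * lam)"
  have "Phi p - Phi xstar \<le> C * (norm (p - z))\<^sup>2"
    if p: "p = fb_step lam gradf g z" and small: "norm (p - z) < e / K" and "Phi p \<le> xi" for z p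
  proof -
    let ?r = "norm (p - z)"
    have res: "norm (fb_step (1 / L) gradf g p - p) \<le> K * ?r"
      unfolding K_def using lam p by (rule fb_residual_le)
    moreover have "K * ?r < e" using small K by (simp add: field_simps)
    moreover have "objective f g p = ereal (Phi p)"
      unfolding p using fb_step_finite[OF lam] by (rule objective_eq)
    ultimately have "infdist p ?X \<le> tau * norm (fb_step (1 / L) gradf g p - p)"
      using \<open>Phi p \<le> xi\<close> by (intro dist_le) (simp_all add: le_max_iff_disj)
    also have "\<dots> \<le> tau * (K * ?r)" using res tau by simp
    finally have inf: "infdist p ?X \<le> tau * K * ?r" by simp
    \<comment> \<open>This slack yields a minimizer nearly attaining \<open>infdist\<close>. For a
      nonzero residual it only raises the factor \<open>tau * K\<close> by one; for a zero residual
      any positive value works, as the product with the residual vanishes.\<close>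
    define d where "d = (if ?r = 0 then 1 else ?r)"
    have "d > 0" unfolding d_def by simp
    with inf have "infdist p ?X < tau * K * ?r + d" by linarith
    then have "(INF v\<in>?X. dist p v) < tau * K * ?r + d"
      using xstar by (subst infdist_notempty[symmetric]) auto
    moreover have "bdd_below (dist p ` ?X)" by (rule bdd_belowI2[of _ 0]) simp
    ultimately obtain v where v: "v \<in> ?X" "norm (v - p) < tau * K * ?r + d"
      using xstar by (subst (asm) cINF_less_iff) (auto simp: dist_norm norm_minus_commute)
    have "?r * norm (v - p) \<le> (tau * K + 1) * ?r\<^sup>2"
    proof (cases "?r = 0")
      case False
      then have "norm (v - p) \<le> (tau * K + 1) * ?r"
        using v(2) by (simp add: d_def algebra_simps)
      then have "?r * norm (v - p) \<le> ?r * ((tau * K + 1) * ?r)"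
        by (rule mult_left_mono) simp
      then show ?thesis by (simp add: power2_eq_square ac_simps)
    qed simp
    moreover have "(norm (v - z))\<^sup>2 \<le> (norm (v - p))\<^sup>2 + 2 * (?r * norm (v - p)) + ?r\<^sup>2"
    proof -
      have "norm (v - z) \<le> norm (v - p) + ?r"
        using norm_triangle_ineq[of "v - p" "p - z"] by simp
      then have "(norm (v - z))\<^sup>2 \<le> (norm (v - p) + ?r)\<^sup>2"
        by (rule power_mono) simp
      then show ?thesis by (simp add: power2_sum ac_simps)
    qed
    ultimately have "(norm (v - z))\<^sup>2 - (norm (v - p))\<^sup>2 \<le> (1 + 2 * (tau * K + 1)) * ?r\<^sup>2"
      by (simp add: algebra_simps)
    then have "((norm (v - z))\<^sup>2 - (norm (v - p))\<^sup>2) / (2 * lam) \<le> C * ?r\<^sup>2"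
      unfolding C_def times_divide_eq_left using lam(1) by (intro divide_right_mono) auto
    moreover have "Phi p + (norm (v - p))\<^sup>2 / (2 * lam) + (1 / (2 * lam) - L / 2) * ?r\<^sup>2
        \<le> Phi v + (norm (v - z))\<^sup>2 / (2 * lam)"
      using lam p minimizer_finite[OF v(1)] by (rule fb_step_descent)
    moreover have "0 \<le> (1 / (2 * lam) - L / 2) * ?r\<^sup>2"
      using lam L_pos by (intro mult_nonneg_nonneg) (auto simp: field_simps)
    moreover have "Phi v = Phi xstar" using v(1) by (rule Phi_minimizer)
    ultimately show ?thesis unfolding diff_divide_distrib by linarith
  qed
  moreover have "e / K > 0" using e K by simp
  moreover have "C > 0" unfolding C_def using tau K lam(1) by (simp add: add_pos_pos)
  ultimately show ?thesis by blast
qed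

end

section \<open>Decay of weighted energies\<close>

text \<open>From \<open>N\<close> on, \<open>E\<close> decreases and is bounded below, so it
  converges and its successive differences, which dominate \<open>b\<close>, tend to zero.\<close>

lemma decrements_tendsto_zero:
  fixes b E :: "nat \<Rightarrow> real"
  assumes step: "\<And>k. k \<ge> N \<Longrightarrow> b k + E (Suc k) \<le> E k"
    and E: "\<And>k. k \<ge> N \<Longrightarrow> 0 \<le> E k" and b: "\<And>k. k \<ge> N \<Longrightarrow> 0 \<le> b k"
  shows "b \<longlonglongrightarrow> 0" and "k \<ge> N \<Longrightarrow> E k \<le> E N"
proof -
  let ?E = "\<lambda>n. E (n + N)"
  have dec: "decseq ?E"
  proof (rule decseq_SucI)
    show "?E (Suc n) \<le> ?E n" for n
      using step[of "n + N"] b[of "n + N"] by simp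
  qed
  then obtain l where l: "?E \<longlonglongrightarrow> l"
    using decseq_convergent[OF dec, of 0] E by (metis le_add2)
  have "(\<lambda>n. ?E n - ?E (Suc n)) \<longlonglongrightarrow> l - l"
    by (intro tendsto_diff l LIMSEQ_Suc[OF l])
  then have *: "(\<lambda>n. ?E n - ?E (Suc n)) \<longlonglongrightarrow> 0" by simp
  have "(\<lambda>n. b (n + N)) \<longlonglongrightarrow> 0"
  proof (rule tendsto_sandwich[OF _ _ tendsto_const *])
    show "eventually (\<lambda>n. 0 \<le> b (n + N)) sequentially"
      using b by simp
    show "eventually (\<lambda>n. b (n + N) \<le> ?E n - ?E (Suc n)) sequentially"
      using step by (simp add: le_diff_eq)
  qed
  then show "b \<longlonglongrightarrow> 0" by (rule LIMSEQ_offset)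
  show "E k \<le> E N" if "k \<ge> N"
    using decseqD[OF dec, of 0 "k - N"] that by simp
qed

text \<open>Multiplying the energy inequality by \<open>(q (Suc k))^2\<close> lets the weights
  cancel the factor \<open>(gam k)^2\<close> in front of \<open>d k\<close>, while the growth of the
  weights is paid out of the gain on \<open>w\<close>.\<close>

lemma damped_energy_decay:
  fixes w d gam q :: "nat \<Rightarrow> real"
  assumes "c > 0"
    and ev: "\<forall>\<^sub>F k in sequentially. 0 \<le> w k \<and> 0 \<le> d k \<and> 0 \<le> gam k \<and> 0 \<le> q k
      \<and> (1 + c) * w (Suc k) + d (Suc k) \<le> w k + (gam k)\<^sup>2 * d k
      \<and> q (Suc k) * gam k \<le> q k \<and> (q (Suc k))\<^sup>2 \<le> (1 + c / 2) * (q k)\<^sup>2"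
  shows "(\<lambda>k. (q k)\<^sup>2 * w k) \<longlonglongrightarrow> 0"
    and "\<exists>B. \<forall>\<^sub>F k in sequentially. (q k)\<^sup>2 * d k \<le> B"
proof -
  from ev obtain N where N: "\<And>k. k \<ge> N \<Longrightarrow> 0 \<le> w k" "\<And>k. k \<ge> N \<Longrightarrow> 0 \<le> d k"
    "\<And>k. k \<ge> N \<Longrightarrow> 0 \<le> gam k" "\<And>k. k \<ge> N \<Longrightarrow> 0 \<le> q k"
    and energy: "\<And>k. k \<ge> N \<Longrightarrow> (1 + c) * w (Suc k) + d (Suc k) \<le> w k + (gam k)\<^sup>2 * d k"
    and q: "\<And>k. k \<ge> N \<Longrightarrow> q (Suc k) * gam k \<le> q k"
      "\<And>k. k \<ge> N \<Longrightarrow> (q (Suc k))\<^sup>2 \<le> (1 + c / 2) * (q k)\<^sup>2"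
    unfolding eventually_sequentially by blast
  \<comment> \<open>The gain \<open>c\<close> is split: one half pays for the growth of
    \<open>q^2\<close>, the other half is left as the decrement of \<open>V\<close>.\<close>
  define V where "V k = (1 + c / 2) * (q k)\<^sup>2 * w k + (q k)\<^sup>2 * d k" for k
  have V_nonneg: "0 \<le> V k" "(q k)\<^sup>2 * d k \<le> V k" if "k \<ge> N" for k
    unfolding V_def using N[OF that] \<open>c > 0\<close> by simp_all
  have step: "c / 2 * ((q (Suc k))\<^sup>2 * w (Suc k)) + V (Suc k) \<le> V k" if k: "k \<ge> N" for k
  proof -
    have "c / 2 * ((q (Suc k))\<^sup>2 * w (Suc k)) + V (Suc k)
        = (q (Suc k))\<^sup>2 * ((1 + c) * w (Suc k) + d (Suc k))"
      unfolding V_def by (simp add: field_simps)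
    also have "\<dots> \<le> (q (Suc k))\<^sup>2 * (w k + (gam k)\<^sup>2 * d k)"
      using energy[OF k] by (rule mult_left_mono) simp
    also have "\<dots> = (q (Suc k))\<^sup>2 * w k + (q (Suc k) * gam k)\<^sup>2 * d k"
      by (simp add: algebra_simps power_mult_distrib)
    also have "\<dots> \<le> (1 + c / 2) * (q k)\<^sup>2 * w k + (q k)\<^sup>2 * d k"
      using q[OF k] N(1-3)[OF k] N(4)[of "Suc k"] k by (intro add_mono mult_right_mono power_mono) auto
    finally show ?thesis unfolding V_def .
  qed
  have "(\<lambda>k. c / 2 * ((q (Suc k))\<^sup>2 * w (Suc k))) \<longlonglongrightarrow> 0"
    using step V_nonneg(1)
  proof (rule decrements_tendsto_zero(1))
    show "0 \<le> c / 2 * ((q (Suc k))\<^sup>2 * w (Suc k))" if "N \<le> k" for k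
      using N(1)[of "Suc k"] that \<open>c > 0\<close> by simp
  qed
  then have "(\<lambda>k. 2 / c * (c / 2 * ((q (Suc k))\<^sup>2 * w (Suc k)))) \<longlonglongrightarrow> 2 / c * 0"
    by (intro tendsto_mult tendsto_const)
  then have "(\<lambda>k. (q (Suc k))\<^sup>2 * w (Suc k)) \<longlonglongrightarrow> 0"
    using \<open>c > 0\<close> by simp
  then show "(\<lambda>k. (q k)\<^sup>2 * w k) \<longlonglongrightarrow> 0" by (rule LIMSEQ_imp_Suc)
  have "V k \<le> V N" if "k \<ge> N" for k
    using step V_nonneg(1) _ that
  proof (rule decrements_tendsto_zero(2))
    show "0 \<le> c / 2 * ((q (Suc k))\<^sup>2 * w (Suc k))" if "N \<le> k" for k
      using N(1)[of "Suc k"] that \<open>c > 0\<close> by simp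
  qed
  then have "(q k)\<^sup>2 * d k \<le> V N" if "k \<ge> N" for k
    using V_nonneg(2) that by (meson order_trans)
  then show "\<exists>B. \<forall>\<^sub>F k in sequentially. (q k)\<^sup>2 * d k \<le> B"
    unfolding eventually_sequentially by blast
qed

section \<open>Power weights and summation of steps\<close>

lemma Bernoulli_inequality_powr:
  fixes p h :: real
  assumes "p \<ge> 1" "h < 1"
  shows "1 - p * h \<le> (1 - h) powr p"
proof -
  have "((\<lambda>x. x powr p) has_real_derivative p) (at 1 within {0<..})"
    by (auto intro!: derivative_eq_intros)
  then have "(1 - h) powr p - 1 powr p \<ge> p * ((1 - h) - 1)"
    using assms powr_convex[of p]
    by (intro convex_on_imp_above_tangent[of "{0<..}"]) (auto simp: interior_open)
  then show ?thesis by (simp add: algebra_simps)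
qed

text \<open>Since \<open>(k - 1) / (k + a) = 1 - (a + 1) / (k + a)\<close>, Bernoulli's inequality
  applies with exponent \<open>a + 1\<close>; this is where the exponent of the rates
  originates.\<close>

lemma inertial_weight_step:
  fixes a k :: real
  assumes "a > 0" "k \<ge> 1"
  shows "(k + a) powr (a + 1) * ((k - 1) / (k + a)) \<le> (k - 1 + a) powr (a + 1)"
proof -
  have "(k - 1) / (k + a) = 1 - (a + 1) * (1 / (k + a))"
    using assms by (simp add: field_simps)
  also have "\<dots> \<le> (1 - 1 / (k + a)) powr (a + 1)"
    using assms by (intro Bernoulli_inequality_powr) auto
  finally have "(k + a) powr (a + 1) * ((k - 1) / (k + a))
      \<le> (k + a) powr (a + 1) * (1 - 1 / (k + a)) powr (a + 1)"
    by (rule mult_left_mono) simp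
  also have "\<dots> = ((k + a) * (1 - 1 / (k + a))) powr (a + 1)"
    using assms by (simp add: powr_mult)
  also have "(k + a) * (1 - 1 / (k + a)) = k - 1 + a"
    using assms by (simp add: field_simps)
  finally show ?thesis .
qed

text \<open>It serves both to bound the growth of consecutive weights and to replace shifted weights
  by powers of \<open>k\<close>.\<close>

lemma tendsto_shift_ratio_powr:
  "(\<lambda>k. ((real k + b) / (real k + d)) powr p) \<longlonglongrightarrow> 1"
proof -
  have "(\<lambda>k. (real k + b) / (real k + d)) \<longlonglongrightarrow> 1"
    by real_asymp
  then have "(\<lambda>k. ((real k + b) / (real k + d)) powr p) \<longlonglongrightarrow> 1 powr p"
    by (rule tendsto_powr) auto
  then show ?thesis by simp
qed

text \<open>The right side is the integral of \<open>s powr (- (a + 1))\<close> over the interval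
  from \<open>j - 1\<close> to \<open>j\<close>. The proof avoids integration through
  \<open>1 + a / j \<le> exp (a / j) \<le> (1 - 1 / j) powr (- a)\<close>.\<close>

lemma powr_telescoping_bound:
  fixes a j :: real
  assumes "a > 0" "j > 1"
  shows "1 / j powr (a + 1) \<le> (1 / (j - 1) powr a - 1 / j powr a) / a"
proof -
  have "1 + a / j \<le> exp (a / j)" by simp
  also have "ln (1 - 1 / j) \<le> - (1 / j)"
    using ln_add_one_self_le_self2[of "- (1 / j)"] assms by simp
  then have "a * ln (1 - 1 / j) \<le> a * (- (1 / j))"
    using assms by (intro mult_left_mono) auto
  then have "exp (a / j) \<le> (1 - 1 / j) powr (- a)"
    using assms by (simp add: powr_def)
  also have "1 - 1 / j = (j - 1) / j" using assms by (simp add: field_simps)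
  also have "((j - 1) / j) powr (- a) = j powr a / (j - 1) powr a"
    using assms by (simp add: powr_minus powr_divide)
  finally have "(1 + a / j) / j powr a \<le> (j powr a / (j - 1) powr a) / j powr a"
    by (rule divide_right_mono) simp
  moreover have "j powr (a + 1) = j * j powr a"
    using assms by (simp add: powr_add)
  ultimately have "a * (1 / j powr (a + 1)) \<le> 1 / (j - 1) powr a - 1 / j powr a"
    using assms by (simp add: add_divide_distrib)
  then show ?thesis using assms by (simp add: pos_le_divide_eq mult.commute)
qed

lemma tendsto_inverse_powr_zero:
  assumes "a > 0"
  shows "(\<lambda>k. M * (1 / real k powr a)) \<longlonglongrightarrow> 0"
  using assms by real_asymp

text \<open>The step bounds telescope; dropping the far end leaves a tail bound uniform in
  \<open>n\<close>, which gives the Cauchy property and, in the limit, the rate.\<close>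

lemma convergent_of_summable_powr_steps:
  fixes x :: "nat \<Rightarrow> 'a::{real_normed_vector, complete_space}"
  assumes a: "a > 0" and N: "N \<ge> 1" and M: "M \<ge> 0"
    and step: "\<And>k. k \<ge> N \<Longrightarrow> norm (x k - x (k - 1)) \<le> M / real k powr (a + 1)"
  shows "\<exists>l. x \<longlonglongrightarrow> l \<and> (\<forall>k\<ge>N. norm (x k - l) \<le> M / a * (1 / real k powr a))"
proof -
  have diff: "norm (x (m + n) - x m) \<le> M / a * (1 / real m powr a - 1 / real (m + n) powr a)"
    if m: "m \<ge> N" for m n
  proof (induction n)
    case (Suc n)
    let ?j = "real (m + Suc n)"
    have "norm (x (m + Suc n) - x m) \<le> norm (x (m + Suc n) - x (m + n)) + norm (x (m + n) - x m)"
      using norm_triangle_ineq[of "x (m + Suc n) - x (m + n)" "x (m + n) - x m"] by simp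
    also have "norm (x (m + Suc n) - x (m + n)) \<le> M * (1 / ?j powr (a + 1))"
      using step[of "m + Suc n"] m by simp
    \<comment> \<open>Because \<open>N \<ge> 1\<close>, the index \<open>?j\<close> is at least 2,
      as the telescoping bound requires.\<close>
    also have "\<dots> \<le> M * ((1 / (?j - 1) powr a - 1 / ?j powr a) / a)"
      using a N m M by (intro mult_left_mono powr_telescoping_bound) auto
    also have "?j - 1 = real (m + n)" by simp
    finally show ?case using Suc.IH by (simp add: algebra_simps diff_divide_distrib)
  qed simp
  have tail: "norm (x (m + n) - x m) \<le> M / a * (1 / real m powr a)" if "m \<ge> N" for m n
    by (rule order_trans[OF diff[OF that]]) (intro mult_left_mono; use a M in simp)
  have "Cauchy x"
  proof (rule CauchyI')
    fix e :: real assume "e > 0"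
    with tendsto_inverse_powr_zero[OF a, of "M / a"]
    have "eventually (\<lambda>k. M / a * (1 / real k powr a) < e) sequentially"
      by (rule order_tendstoD(2))
    then obtain K where K: "\<And>k. k \<ge> K \<Longrightarrow> M / a * (1 / real k powr a) < e"
      unfolding eventually_sequentially by blast
    have "dist (x m) (x n) < e" if "m \<ge> max K N" "n > m" for m n
      using tail[of m "n - m"] K[of m] that by (simp add: dist_norm norm_minus_commute)
    then show "\<exists>K. \<forall>m\<ge>K. \<forall>n>m. dist (x m) (x n) < e" by blast
  qed
  then obtain l where l: "x \<longlonglongrightarrow> l"
    using Cauchy_convergent convergent_def by blast
  have "norm (x m - l) \<le> M / a * (1 / real m powr a)" if "m \<ge> N" for m
  proof -
    have "(\<lambda>n. x (n + m)) \<longlonglongrightarrow> l" using l by (rule LIMSEQ_ignore_initial_segment)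
    then have "(\<lambda>n. norm (x (n + m) - x m)) \<longlonglongrightarrow> norm (l - x m)"
      by (intro tendsto_intros)
    then have "norm (l - x m) \<le> M / a * (1 / real m powr a)"
      by (rule tendsto_upperbound) (use tail[OF that] in \<open>auto simp: add.commute\<close>)
    then show ?thesis by (simp add: norm_minus_commute)
  qed
  with l show ?thesis by blast
qed

section \<open>Convergence rates of the inertial iteration\<close>

theorem corollary3p6:
  fixes f :: "'a::{real_inner, complete_space} \<Rightarrow> real"
    and gradf :: "'a \<Rightarrow> 'a"
    and g :: "'a \<Rightarrow> ereal"
    and L mu a :: real
    and t :: "nat \<Rightarrow> real"
    and x y :: "nat \<Rightarrow> 'a"
    and xstar :: 'a
  assumes "convex_on UNIV f"
    and "\<And>z. GDERIV f z :> gradf z"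
    and "L > 0"
    and "L-lipschitz_on UNIV gradf"
    and "proper g"
    and "lower_semicontinuous g"
    and "convex_ereal g"
    and "0 < mu" and "mu < 1"
    and "a > 0"
    and "\<And>k. k \<ge> 1 \<Longrightarrow> t k = (real k - 1 + a) / a"
    and "local_error_bound f gradf g L"
    and "inertial_forward_backward (mu / L) gradf g t x y"
    and "xstar \<in> minimizers (objective f g)"
  shows "(\<forall>k\<ge>1. \<bar>objective f g (x k)\<bar> \<noteq> \<infinity>) \<and> \<bar>objective f g xstar\<bar> \<noteq> \<infinity>
    \<and> (\<lambda>k. real_of_ereal (objective f g (x k) - objective f g xstar))
        \<in> o(\<lambda>k. 1 / real k powr (2 * (a + 1)))
    \<and> (\<lambda>k. norm (x k - x (k - 1))) \<in> O(\<lambda>k. 1 / real k powr (a + 1))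
    \<and> (\<exists>xbar \<in> minimizers (objective f g). x \<longlonglongrightarrow> xbar
         \<and> (\<lambda>k. norm (x k - xbar)) \<in> O(\<lambda>k. 1 / real k powr a))"
proof -
  interpret composite_minimization f gradf g L xstar
    using assms(1-7,14) by unfold_locales
  define lam where "lam = mu / L"
  have lam: "0 < lam" "lam \<le> 1 / L" "lam < 1 / L"
    using assms(3,8,9) by (auto simp: lam_def divide_right_mono divide_strict_right_mono)
  \<comment> \<open>This is the inertial factor \<open>(t k - 1) / t (k + 1)\<close> after the
    common denominator \<open>a\<close> has cancelled.\<close>
  define gam where "gam k = (real k - 1) / (real k + a)" for k
  have gam: "0 \<le> gam k" "gam k \<le> 1" if "k \<ge> 1" for k
    using that assms(10) by (auto simp: gam_def)
  have x_eq: "x k = fb_step lam gradf g (y k)" if "k \<ge> 1" for k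
    using assms(13) that unfolding inertial_forward_backward_def lam_def by blast
  have y_eq: "y (Suc k) = x k + gam k *\<^sub>R (x k - x (k - 1))" if "k \<ge> 1" for k
  proof -
    have "t k - 1 = (real k - 1) / a" "t (k + 1) = (real k + a) / a"
      using assms(10) assms(11)[of k] assms(11)[of "k + 1"] that
      by (simp_all add: diff_divide_distrib add_divide_distrib)
    then have "(t k - 1) / t (k + 1) = gam k"
      unfolding gam_def using assms(10) by simp
    then show ?thesis
      using assms(13) that unfolding inertial_forward_backward_def by auto
  qed
  \<comment> \<open>The starting point \<open>x 0\<close> may lie outside the domain of
    \<open>g\<close>; estimates of values therefore begin at index 1, the first result of a
    step.\<close>
  have fin: "g (x k) \<noteq> \<infinity>" if "k \<ge> 1" for k
    unfolding x_eq[OF that] using lam(1,2) by (rule fb_step_finite)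
  define w where "w k = Phi (x k) - Phi xstar" for k
  define d where "d k = (norm (x k - x (k - 1)))\<^sup>2 / (2 * lam)" for k
  define r where "r k = norm (x k - y k)" for k
  define kap where "kap = 1 / (2 * lam) - L / 2"
  have kap: "kap > 0"
    unfolding kap_def using lam assms(3) by (simp add: field_simps)
  have w_nonneg: "0 \<le> w k" if "k \<ge> 1" for k
    unfolding w_def using Phi_ge_minimizer[OF xstar fin[OF that]] by simp
  have d_nonneg: "0 \<le> d k" for k
    unfolding d_def using lam by simp
  \<comment> \<open>The descent estimate is used from \<open>y (Suc k)\<close> with comparison point
    \<open>x k\<close>, whose distance to \<open>y (Suc k)\<close> is
    \<open>gam k * norm (x k - x (k - 1))\<close>.\<close>
  have energy: "w (Suc k) + d (Suc k) + kap * (r (Suc k))\<^sup>2 \<le> w k + (gam k)\<^sup>2 * d k"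
    if k: "k \<ge> 1" for k
  proof -
    have "Phi (x (Suc k)) + (norm (x k - x (Suc k)))\<^sup>2 / (2 * lam) + kap * (r (Suc k))\<^sup>2
        \<le> Phi (x k) + (norm (x k - y (Suc k)))\<^sup>2 / (2 * lam)"
      unfolding kap_def r_def using lam(1,2) x_eq fin[OF k] by (intro fb_step_descent) auto
    moreover have "(norm (x k - y (Suc k)))\<^sup>2 / (2 * lam) = (gam k)\<^sup>2 * d k"
      unfolding y_eq[OF k] d_def by (simp add: power_mult_distrib)
    ultimately show ?thesis
      unfolding w_def d_def by (simp add: norm_minus_commute)
  qed
  \<comment> \<open>Already \<open>gam k \<le> 1\<close> makes \<open>w + d\<close> decrease. This
    gives vanishing residuals and bounded values, the two conditions under which the local error
    bound can be invoked.\<close>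
  have step: "kap * (r (Suc k))\<^sup>2 + (w (Suc k) + d (Suc k)) \<le> w k + d k" if k: "k \<ge> 1" for k
  proof -
    have "(gam k)\<^sup>2 \<le> 1" using gam[OF k] by (simp add: power_le_one)
    then have "(gam k)\<^sup>2 * d k \<le> d k" using d_nonneg mult_right_mono by fastforce
    with energy[OF k] show ?thesis by linarith
  qed
  have E_nonneg: "0 \<le> w k + d k" if "k \<ge> 1" for k
    using w_nonneg[OF that] d_nonneg[of k] by simp
  have r2_nonneg: "0 \<le> kap * (r (Suc k))\<^sup>2" for k
    using kap by simp
  have "(\<lambda>k. kap * (r (Suc k))\<^sup>2) \<longlonglongrightarrow> 0"
    using step E_nonneg r2_nonneg by (rule decrements_tendsto_zero(1))
  then have "(\<lambda>k. 1 / kap * (kap * (r (Suc k))\<^sup>2)) \<longlonglongrightarrow> 1 / kap * 0"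
    by (intro tendsto_mult tendsto_const)
  then have "(\<lambda>k. (r (Suc k))\<^sup>2) \<longlonglongrightarrow> 0"
    using kap by simp
  then have r_lim: "(\<lambda>k. r (Suc k)) \<longlonglongrightarrow> 0"
    by simp
  have E_le: "w k + d k \<le> w 1 + d 1" if "k \<ge> 1" for k
    using step E_nonneg r2_nonneg that by (rule decrements_tendsto_zero(2))
  \<comment> \<open>This level does not depend on \<open>k\<close>, so a single pair
    \<open>eps\<close>, \<open>C\<close> serves the whole iteration.\<close>
  have Phi_le: "Phi (x k) \<le> Phi xstar + w 1 + d 1" if "k \<ge> 1" for k
    using E_le[OF that] d_nonneg[of k] unfolding w_def by linarith

  \<comment> \<open>Gain from the error bound\<close>
  obtain eps C where "eps > 0" and C: "C > 0" and gap:
    "\<And>z p. p = fb_step lam gradf g z \<Longrightarrow> norm (p - z) < eps \<Longrightarrow> Phi p \<le> Phi xstar + w 1 + d 1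
      \<Longrightarrow> Phi p - Phi xstar \<le> C * (norm (p - z))\<^sup>2"
    using ex_value_gap_bound[OF lam(1,2) assms(12)] by metis
  \<comment> \<open>With this ratio, the bound \<open>w \<le> C * r^2\<close> turns the surplus
    \<open>kap * r^2\<close> into at least \<open>c * w\<close>.\<close>
  define c where "c = kap / C"
  have c: "c > 0" unfolding c_def using kap C by simp
  have energy_c: "\<forall>\<^sub>F k in sequentially. (1 + c) * w (Suc k) + d (Suc k) \<le> w k + (gam k)\<^sup>2 * d k"
    using order_tendstoD(2)[OF r_lim \<open>eps > 0\<close>] eventually_ge_at_top[of 1]
  proof eventually_elim
    case (elim k)
    have "w (Suc k) \<le> C * (r (Suc k))\<^sup>2"
      unfolding w_def r_def using elim(1) Phi_le x_eq by (intro gap) (auto simp: r_def)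
    then have "c * w (Suc k) \<le> c * (C * (r (Suc k))\<^sup>2)"
      using c by (intro mult_left_mono) auto
    also have "\<dots> = kap * (r (Suc k))\<^sup>2"
      unfolding c_def using C by simp
    finally show ?case using energy[OF elim(2)] by (simp add: algebra_simps)
  qed
  define q where "q k = (real k - 1 + a) powr (a + 1)" for k
  have q2: "(q k)\<^sup>2 = (real k - 1 + a) powr (2 * (a + 1))" for k
    unfolding q_def power2_eq_square powr_add[symmetric] by (simp only: mult_2)
  \<comment> \<open>The ratio of consecutive squared weights tends to 1, so it eventually falls
    below \<open>1 + c / 2\<close>, however small the gain \<open>c\<close> is.\<close>
  have q_ratio: "\<forall>\<^sub>F k in sequentially. (q (Suc k))\<^sup>2 \<le> (1 + c / 2) * (q k)\<^sup>2"
  proof -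
    have "\<forall>\<^sub>F k in sequentially.
        ((real k + a) / (real k + (a - 1))) powr (2 * (a + 1)) < 1 + c / 2"
      using c by (intro order_tendstoD(2)[OF tendsto_shift_ratio_powr]) simp
    then show ?thesis using eventually_ge_at_top[of 1]
    proof eventually_elim
      case (elim k)
      have pos: "0 < real k - 1 + a" "0 < real k + a" using elim(2) assms(10) by auto
      have "((real k + a) / (real k + (a - 1))) powr (2 * (a + 1)) = (q (Suc k))\<^sup>2 / (q k)\<^sup>2"
        unfolding q2 using pos by (simp add: powr_divide algebra_simps)
      with elim(1) have "(q (Suc k))\<^sup>2 / (q k)\<^sup>2 < 1 + c / 2" by simp
      moreover have "(q k)\<^sup>2 > 0" unfolding q2 using pos by simp
      ultimately show ?case by (simp add: pos_divide_less_eq)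
    qed
  qed
  have q_step: "q (Suc k) * gam k \<le> q k" if "k \<ge> 1" for k
    using inertial_weight_step[OF assms(10), of "real k"] that unfolding q_def gam_def by simp
  have ev: "\<forall>\<^sub>F k in sequentially. 0 \<le> w k \<and> 0 \<le> d k \<and> 0 \<le> gam k \<and> 0 \<le> q k
      \<and> (1 + c) * w (Suc k) + d (Suc k) \<le> w k + (gam k)\<^sup>2 * d k
      \<and> q (Suc k) * gam k \<le> q k \<and> (q (Suc k))\<^sup>2 \<le> (1 + c / 2) * (q k)\<^sup>2"
    using energy_c q_ratio eventually_ge_at_top[of 1]
  proof eventually_elim
    case (elim k)
    then show ?case using w_nonneg d_nonneg gam q_step by (auto simp: q_def)
  qed

  \<comment> \<open>Decay rates of values and steps\<close>
  have w_lim: "(\<lambda>k. (q k)\<^sup>2 * w k) \<longlonglongrightarrow> 0"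
    using c ev by (rule damped_energy_decay(1))
  obtain B where B: "\<forall>\<^sub>F k in sequentially. (q k)\<^sup>2 * d k \<le> B"
    using damped_energy_decay(2)[OF c ev] by blast
  \<comment> \<open>The weights have base \<open>real k - 1 + a\<close>; the ratio factor, which
    tends to 1, changes it to \<open>real k\<close>.\<close>
  have kw_lim: "(\<lambda>k. w k * real k powr (2 * (a + 1))) \<longlonglongrightarrow> 0"
  proof -
    have "(\<lambda>k. (q k)\<^sup>2 * w k * ((real k + 0) / (real k + (a - 1))) powr (2 * (a + 1)))
        \<longlonglongrightarrow> 0 * 1"
      by (intro tendsto_mult w_lim tendsto_shift_ratio_powr)
    moreover have "\<forall>\<^sub>F k in sequentially.
        (q k)\<^sup>2 * w k * ((real k + 0) / (real k + (a - 1))) powr (2 * (a + 1))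
          = w k * real k powr (2 * (a + 1))"
      using eventually_ge_at_top[of 1]
    proof eventually_elim
      case (elim k)
      have "0 < real k - 1 + a" using elim assms(10) by auto
      then show ?case unfolding q2 by (simp add: powr_divide algebra_simps)
    qed
    ultimately have "(\<lambda>k. w k * real k powr (2 * (a + 1))) \<longlonglongrightarrow> 0 * 1"
      by (rule Lim_transform_eventually)
    then show ?thesis by simp
  qed
  have obj_diff: "real_of_ereal (objective f g (x k) - objective f g xstar) = w k" if "k \<ge> 1" for k
    using objective_eq[OF fin[OF that]] objective_eq[OF minimizer_finite[OF xstar]]
    unfolding w_def by simp
  have values_rate: "(\<lambda>k. real_of_ereal (objective f g (x k) - objective f g xstar))
      \<in> o(\<lambda>k. 1 / real k powr (2 * (a + 1)))"
  proof (rule smalloI_tendsto)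
    have "\<forall>\<^sub>F k in sequentially. w k * real k powr (2 * (a + 1))
        = real_of_ereal (objective f g (x k) - objective f g xstar) / (1 / real k powr (2 * (a + 1)))"
      using eventually_ge_at_top[of 1] by eventually_elim (simp add: obj_diff)
    with kw_lim show "(\<lambda>k. real_of_ereal (objective f g (x k) - objective f g xstar)
        / (1 / real k powr (2 * (a + 1)))) \<longlonglongrightarrow> 0"
      by (rule Lim_transform_eventually)
    show "\<forall>\<^sub>F k in sequentially. 1 / real k powr (2 * (a + 1)) \<noteq> 0"
      using eventually_ge_at_top[of 1] by eventually_elim simp
  qed
  \<comment> \<open>The root bounds \<open>q k * norm (x k - x (k - 1))\<close> through the bound
    \<open>B\<close> on the weighted \<open>d\<close>; the factor 2 eventually bounds
    \<open>real k powr (a + 1) / q k\<close>. The absolute value is there because \<open>B\<close>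
    comes without a sign.\<close>
  define M where "M = 2 * sqrt (2 * lam * \<bar>B\<bar>)"
  have M: "M \<ge> 0" unfolding M_def using lam by simp
  have "\<forall>\<^sub>F k in sequentially. ((real k + 0) / (real k + (a - 1))) powr (a + 1) < 2"
    by (intro order_tendstoD(2)[OF tendsto_shift_ratio_powr]) simp
  with B have "\<forall>\<^sub>F k in sequentially. norm (x k - x (k - 1)) \<le> M / real k powr (a + 1)"
    using eventually_ge_at_top[of 1]
  proof eventually_elim
    case (elim k)
    let ?n = "norm (x k - x (k - 1))"
    have pos: "0 < real k - 1 + a" using elim(3) assms(10) by auto
    have "(q k * ?n)\<^sup>2 = 2 * lam * ((q k)\<^sup>2 * d k)"
      unfolding d_def using lam by (simp add: power_mult_distrib)
    also have "\<dots> \<le> 2 * lam * \<bar>B\<bar>"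
      using elim(1) lam by (intro mult_left_mono) auto
    finally have "q k * ?n \<le> sqrt (2 * lam * \<bar>B\<bar>)"
      by (rule real_le_rsqrt)
    moreover have "real k powr (a + 1) \<le> 2 * q k"
      using elim(2) pos unfolding q_def by (simp add: powr_divide divide_simps algebra_simps)
    then have "real k powr (a + 1) * ?n \<le> 2 * q k * ?n"
      by (rule mult_right_mono) simp
    ultimately have "real k powr (a + 1) * ?n \<le> M" unfolding M_def by linarith
    then show ?case using elim(3) by (simp add: pos_le_divide_eq mult.commute)
  qed

  \<comment> \<open>Convergence of the iterates\<close>
  then obtain N where N: "N \<ge> 1"
    and steps_le: "\<And>k. k \<ge> N \<Longrightarrow> norm (x k - x (k - 1)) \<le> M / real k powr (a + 1)"
    unfolding eventually_sequentially by (metis max.bounded_iff max.cobounded1 max.cobounded2)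
  have steps_rate: "(\<lambda>k. norm (x k - x (k - 1))) \<in> O(\<lambda>k. 1 / real k powr (a + 1))"
    using steps_le by (intro bigoI[of _ M] eventually_sequentiallyI[of N]) auto
  obtain xbar where xbar: "x \<longlonglongrightarrow> xbar"
    and rate: "\<And>k. k \<ge> N \<Longrightarrow> norm (x k - xbar) \<le> M / a * (1 / real k powr a)"
    using convergent_of_summable_powr_steps[OF assms(10) N M steps_le] by blast

  \<comment> \<open>Optimality of the limit\<close>
  have "xbar \<in> minimizers (objective f g)"
  proof -
    have "(\<lambda>k. w k * real k powr (2 * (a + 1)) * (1 * (1 / real k powr (2 * (a + 1)))))
        \<longlonglongrightarrow> 0 * 0"
      using assms(10) by (intro tendsto_mult[OF kw_lim] tendsto_inverse_powr_zero) simp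
    moreover have "\<forall>\<^sub>F k in sequentially.
        w k * real k powr (2 * (a + 1)) * (1 * (1 / real k powr (2 * (a + 1)))) = w k"
      using eventually_ge_at_top[of 1] by eventually_elim simp
    ultimately have "w \<longlonglongrightarrow> 0 * 0" by (rule Lim_transform_eventually)
    then have "w \<longlonglongrightarrow> 0" by simp
    \<comment> \<open>The semicontinuity lemma needs its bound at every index, and
      \<open>g (x 0)\<close> may be infinite; the shift discards it.\<close>
    then have w_Suc: "(\<lambda>k. w (Suc k)) \<longlonglongrightarrow> 0" by (rule LIMSEQ_Suc)
    have "isCont f xbar"
      using gradient[of xbar] unfolding gderiv_def by (rule has_derivative_continuous)
    then have f_lim: "(\<lambda>k. f (x (Suc k))) \<longlonglongrightarrow> f xbar"
      using LIMSEQ_Suc[OF xbar] by (rule isCont_tendsto_compose)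
    have "g xbar \<le> ereal (Phi xstar + 0 - f xbar)"
    proof (rule lower_semicontinuous_seq_le[OF assms(6) LIMSEQ_Suc[OF xbar]])
      show "g (x (Suc n)) \<le> ereal (Phi xstar + w (Suc n) - f (x (Suc n)))" for n
        using g_eq[OF fin[of "Suc n"]] by (simp add: w_def Phi_def)
      show "(\<lambda>n. Phi xstar + w (Suc n) - f (x (Suc n))) \<longlonglongrightarrow> Phi xstar + 0 - f xbar"
        by (intro tendsto_intros w_Suc f_lim)
    qed
    then have "objective f g xbar \<le> ereal (f xbar) + ereal (Phi xstar - f xbar)"
      unfolding objective_def by (intro add_left_mono) simp
    also have "\<dots> = objective f g xstar"
      using objective_eq[OF minimizer_finite[OF xstar]] by simp
    finally have "objective f g xbar \<le> objective f g u" for u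
      using objective_ge_minimizer[OF xstar] order_trans by blast
    then show ?thesis by (simp add: minimizers_def is_arg_min_linorder)
  qed
  moreover have "(\<lambda>k. norm (x k - xbar)) \<in> O(\<lambda>k. 1 / real k powr a)"
    using rate by (intro bigoI[of _ "M / a"] eventually_sequentiallyI[of N]) auto
  ultimately show ?thesis
    using values_rate steps_rate xbar objective_eq[OF fin] objective_eq[OF minimizer_finite[OF xstar]] by auto
qed

end
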